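(* Let $n\ge 1$ and let $S$ be a set of $2n$ points in $\mathbb R^2$. Let $\{a_ib_i : i=1,\dots,n\}$ be a max-sum matching of $S$. Then there exists a point $o\in\mathbb R^2$ such that \[ \|a_i-o\|+\|b_i-o\|\le \frac{2}{\sqrt3}\,\|a_i-b_i\| \quad\text{for all } i=1,\dots,n. \] Equivalently, $\bigcap_{i=1}^n \mathcal E(a_ib_i)\neq\emptyset$.
   Context: $\|\cdot\|$ is the Euclidean norm. For an even finite set $S\subset\mathbb R^2$, a perfect matching $\mathcal M$ of $S$ is a partition of $S$ into unordered pairs (edges); its cost is $\sum_{ab\in\mathcal M}\|a-b\|$. A max-sum matching of $S$ is a perfect matching of $S$ of maximum cost. For points $a,b\in\mathbb R^2$, $\mathcal E(ab)=\{x\in\mathbb R^2: \|a-x\|+\|b-x\|\le \tfrac{2}{\sqrt3}\|a-b\|\}$. *)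

theory Defs
  imports "HOL-Analysis.Analysis"
begin

type_synonym point = "real^2"

definition perfect_matching :: "point set \<Rightarrow> point set set \<Rightarrow> bool" where
  "perfect_matching S M \<longleftrightarrow>
     (\<forall>e\<in>M. \<exists>a b. a \<noteq> b \<and> e = {a, b}) \<and> \<Union>M = S \<and> pairwise disjnt M"

definition edge_len :: "point set \<Rightarrow> real" where
  "edge_len e = (THE d. \<exists>a b. e = {a, b} \<and> d = norm (a - b))"

definition matching_cost :: "point set set \<Rightarrow> real" where
  "matching_cost M = (\<Sum>e\<in>M. edge_len e)"

definition max_sum_matching :: "point set \<Rightarrow> point set set \<Rightarrow> bool" where
  "max_sum_matching S M \<longleftrightarrow> perfect_matching S M \<and>
     (\<forall>M'. perfect_matching S M' \<longrightarrow> matching_cost M' \<le> matching_cost M)"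

end

theory Submission
  imports Defs
begin

text \<open>
  By Helly's theorem it suffices to treat three edges. For these we find radii \<open>y\<close> on the six endpoints with
  \<open>y a + y b = \<parallel>a - b\<parallel>\<close> on every edge and \<open>\<parallel>u - v\<parallel> \<le> y u + y v\<close> for every pair: the edges become pairs of
  tangent discs, and all discs meet pairwise. Enlarged by the factor \<open>2 / sqrt 3\<close>, pairwise meeting discs in the
  plane have a common point \<open>c\<close> (Helly, and the one-point case of Kirszbraun's theorem applied to three points
  seen from the origin at mutual angles of 120 degrees), and adding the two inequalities of an edge gives the claim.

  The radii are a dual solution of the fractional matching problem. They exist iff no fractional perfect
  matching beats the given one, and the only fractional competitors that are not averages of perfect matchings
  are pairs of half-weighted triangles. Those are excluded by planarity: the complete bipartite graph between
  the two triangles has no plane straight-line drawing, so two of its disjoint edges cross, and uncrossing them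
  turns the two triangles into two perfect matchings of at least the same total length.
\<close>

section \<open>Exchange inequalities\<close>

lemma edge_len_doubleton: "edge_len {a, b} = norm (a - b)"
  unfolding edge_len_def
  by (rule the_equality) (auto simp: doubleton_eq_iff norm_minus_commute)

text \<open>Edges outside \<open>T\<close> are disjoint from the union of \<open>T\<close>, so
  exchanging \<open>T\<close> for \<open>N\<close> gives another perfect matching of
  \<open>S\<close>. The cost splits additively: edges are nonempty, hence no edge of
  \<open>N\<close> lies in \<open>M - T\<close>.\<close>

lemma max_sum_matching_exchange:
  assumes "finite S" and max: "max_sum_matching S M" and T: "T \<subseteq> M" and N: "perfect_matching (\<Union>T) N"
  shows "matching_cost N \<le> matching_cost T"
proof -
  have M: "perfect_matching S M" using max by (simp add: max_sum_matching_def)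
  have dis: "disjnt e (\<Union>T)" if "e \<in> M - T" for e
    unfolding disjnt_Union2
  proof
    fix f assume "f \<in> T"
    then have "f \<in> M" "e \<in> M" "e \<noteq> f" using that T by auto
    then show "disjnt e f" using M by (auto simp: perfect_matching_def pairwise_def)
  qed
  have Nsub: "e \<subseteq> \<Union>T" "e \<noteq> {}" if "e \<in> N" for e
    using N that unfolding perfect_matching_def by auto
  have disMN: "disjnt e f" if "e \<in> M - T" "f \<in> N" for e f
    using dis[OF that(1)] Nsub(1)[OF that(2)] by (rule disjnt_subset2)
  have "perfect_matching S ((M - T) \<union> N)"
    unfolding perfect_matching_def
  proof (intro conjI ballI)
    show "\<exists>a b. a \<noteq> b \<and> e = {a, b}" if "e \<in> (M - T) \<union> N" for e
      using that M N unfolding perfect_matching_def by auto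
    show "\<Union>((M - T) \<union> N) = S"
      using M N T unfolding perfect_matching_def by blast
    show "pairwise disjnt ((M - T) \<union> N)"
      using M N disMN unfolding perfect_matching_def pairwise_def
      by (metis DiffD1 UnE disjnt_sym)
  qed
  then have le: "matching_cost ((M - T) \<union> N) \<le> matching_cost M"
    using max by (simp add: max_sum_matching_def)
  have "M \<subseteq> Pow S" using M unfolding perfect_matching_def by auto
  moreover have "N \<subseteq> Pow S" using Nsub(1) T calculation by fastforce
  ultimately have fin: "finite M" "finite N" using \<open>finite S\<close> by (auto intro: finite_subset)
  have "(M - T) \<inter> N = {}"
  proof (rule ccontr)
    assume "(M - T) \<inter> N \<noteq> {}"
    then obtain e where "e \<in> M - T" "e \<in> N" by blast
    with disMN[of e e] Nsub(2)[of e] show False by (simp add: disjnt_def)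
  qed
  then have "matching_cost ((M - T) \<union> N) = matching_cost (M - T) + matching_cost N"
    unfolding matching_cost_def using fin by (intro sum.union_disjoint) auto
  moreover have "matching_cost M = matching_cost (M - T) + matching_cost T"
    unfolding matching_cost_def using fin T by (simp add: sum.subset_diff)
  ultimately show ?thesis using le by simp
qed

lemma perfect_matching_distinct:
  assumes "perfect_matching S M" "{a, b} \<in> M" "{c, d} \<in> M" "{a, b} \<noteq> {c, d}"
  shows "a \<noteq> b" "c \<noteq> d" "a \<noteq> c" "a \<noteq> d" "b \<noteq> c" "b \<noteq> d"
proof -
  have "x \<noteq> y" if xy: "{x, y} \<in> M" for x y
  proof -
    from assms(1) have "\<forall>e\<in>M. \<exists>u v. u \<noteq> v \<and> e = {u, v}" by (simp add: perfect_matching_def)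
    from bspec[OF this xy] obtain u v where "u \<noteq> v" "{x, y} = {u, v}" by (elim exE conjE)
    then show ?thesis by (auto simp: doubleton_eq_iff)
  qed
  from this[OF assms(2)] this[OF assms(3)] show "a \<noteq> b" "c \<noteq> d" .
  have "pairwise disjnt M" using assms(1) by (simp add: perfect_matching_def)
  then have "disjnt {a, b} {c, d}" using assms(2-4) by (rule pairwiseD)
  then show "a \<noteq> c" "a \<noteq> d" "b \<noteq> c" "b \<noteq> d"
    by (auto simp: disjnt_def)
qed

lemma max_sum_matching_swap:
  assumes S: "finite S" and max: "max_sum_matching S M" and e: "{a, b} \<in> M" and f: "{c, d} \<in> M"
  shows "norm (a - c) + norm (b - d) \<le> norm (a - b) + norm (c - d)"
proof (cases "{a, b} = {c, d}")
  case True
  then show ?thesis by (auto simp: doubleton_eq_iff norm_minus_commute)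
next
  case False
  have M: "perfect_matching S M" using max by (simp add: max_sum_matching_def)
  note ne = perfect_matching_distinct[OF M e f False]
  have "perfect_matching (\<Union>{{a, b}, {c, d}}) {{a, c}, {b, d}}"
    using ne unfolding perfect_matching_def pairwise_def disjnt_def by auto
  from max_sum_matching_exchange[OF S max _ this] e f
  have "matching_cost {{a, c}, {b, d}} \<le> matching_cost {{a, b}, {c, d}}" by simp
  moreover have "{a, c} \<noteq> {b, d}" using ne by (auto simp: doubleton_eq_iff)
  ultimately show ?thesis
    using False by (simp add: matching_cost_def edge_len_doubleton)
qed

text \<open>Exchange along an alternating hexagon. If two edges coincide, the exchange of two edges
  and the triangle inequality give the same bound.\<close>

lemma max_sum_matching_cycle:
  assumes S: "finite S" and max: "max_sum_matching S M"
    and e: "{a, b} \<in> M" and f: "{c, d} \<in> M" and g: "{x, y} \<in> M"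
  shows "norm (b - c) + norm (d - x) + norm (y - a) \<le> norm (a - b) + norm (c - d) + norm (x - y)"
proof -
  note swap = max_sum_matching_swap[OF S max]
  have degenerate: "norm (b - c) + norm (d - x) + norm (y - a) \<le> norm (a - b) + norm (c - d) + norm (x - y)"
    if "{a, b} = {c, d}" "{c, d} \<in> M" "{x, y} \<in> M" for a b c d x y :: point
  proof -
    have 1: "{a, b} \<in> M" "{b, a} \<in> M" using that by (simp_all add: insert_commute)
    have 2: "norm (b - x) + norm (a - y) \<le> norm (b - a) + norm (x - y)"
      using swap[OF 1(2) that(3)] .
    have 3: "norm (a - x) \<le> norm (a - b) + norm (b - x)"
      using norm_triangle_ineq[of "a - b" "b - x"] by simp
    from that(1) consider "c = a" "d = b" | "c = b" "d = a" by (auto simp: doubleton_eq_iff)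
    then show ?thesis
      using 2 3 norm_minus_commute[of a b] norm_minus_commute[of a y] by cases simp_all
  qed
  consider "{a, b} = {c, d}" | "{c, d} = {x, y}" | "{x, y} = {a, b}"
    | "{a, b} \<noteq> {c, d}" "{c, d} \<noteq> {x, y}" "{x, y} \<noteq> {a, b}" by blast
  then show ?thesis
  proof cases
    case 1
    then show ?thesis using degenerate f g by blast
  next
    case 2
    then show ?thesis using degenerate[of c d x y a b] g e by simp
  next
    case 3
    then show ?thesis using degenerate[of x y a b c d] e f by simp
  next
    case 4
    have M: "perfect_matching S M" using max by (simp add: max_sum_matching_def)
    note ne = perfect_matching_distinct[OF M e f 4(1)] perfect_matching_distinct[OF M f g 4(2)]
      perfect_matching_distinct[OF M g e 4(3)]
    have "perfect_matching (\<Union>{{a, b}, {c, d}, {x, y}}) {{b, c}, {d, x}, {y, a}}"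
      unfolding perfect_matching_def
    proof (intro conjI)
      show "\<forall>e\<in>{{b, c}, {d, x}, {y, a}}. \<exists>a b. a \<noteq> b \<and> e = {a, b}" using ne by auto
      show "pairwise disjnt {{b, c}, {d, x}, {y, a}}" using ne by (auto simp: pairwise_insert disjnt_def)
    qed auto
    from max_sum_matching_exchange[OF S max _ this] e f g
    have "matching_cost {{b, c}, {d, x}, {y, a}} \<le> matching_cost {{a, b}, {c, d}, {x, y}}" by simp
    moreover have "{b, c} \<noteq> {d, x}" "{b, c} \<noteq> {y, a}" "{d, x} \<noteq> {y, a}"
      using ne by (auto simp: doubleton_eq_iff)
    ultimately show ?thesis
      using 4 by (simp add: matching_cost_def edge_len_doubleton insert_commute norm_minus_commute)
  qed
qed

section \<open>Pairwise meeting discs\<close>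

text \<open>\<open>Helly\<close> concerns at least three distinct sets, whereas an indexed family
  may collapse to one or two; a triple with repeated indices then gives the point.\<close>

lemma Helly_plane_indexed:
  fixes C :: "'i \<Rightarrow> point set"
  assumes "finite I" and "I \<noteq> {}" and cvx: "\<And>i. i \<in> I \<Longrightarrow> convex (C i)"
    and triple: "\<And>i j k. i \<in> I \<Longrightarrow> j \<in> I \<Longrightarrow> k \<in> I \<Longrightarrow> C i \<inter> C j \<inter> C k \<noteq> {}"
  shows "(\<Inter>i\<in>I. C i) \<noteq> {}"
proof (cases "card (C ` I) \<ge> 3")
  case True
  show ?thesis
  proof (rule Helly)
    show "card (C ` I) \<ge> DIM(point) + 1" using True by simp
    show "\<forall>s\<in>C ` I. convex s" using cvx by blast
  next
    fix t assume t: "t \<subseteq> C ` I" "card t = DIM(point) + 1"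
    then have "card t = 3" by simp
    then obtain x y z where xyz: "t = {x, y, z}" by (auto simp: card_3_iff)
    then have "x \<in> C ` I" "y \<in> C ` I" "z \<in> C ` I" using t(1) by auto
    then obtain i j k where "i \<in> I" "j \<in> I" "k \<in> I" "x = C i" "y = C j" "z = C k"
      by (elim imageE)
    then show "\<Inter>t \<noteq> {}" using triple[of i j k] by (simp add: xyz Int_assoc)
  qed
next
  case False
  have "card (C ` I) \<noteq> 0" using assms(1,2) by simp
  with False have "card (C ` I) = 1 \<or> card (C ` I) = 2" by linarith
  then obtain x y where xy: "C ` I = {x, y}"
    by (auto simp: card_1_singleton_iff card_2_iff)
  then have "x \<in> C ` I" "y \<in> C ` I" by simp_all
  then obtain i j where "i \<in> I" "j \<in> I" "x = C i" "y = C j" by (elim imageE)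
  with triple[of i j j] xy show ?thesis by auto
qed

lemma norm_diff_scaleR_power2:
  fixes v d :: "'a::real_inner"
  shows "(norm (v - e *\<^sub>R d))\<^sup>2 = (norm v)\<^sup>2 - 2 * e * (v \<bullet> d) + e\<^sup>2 * (norm d)\<^sup>2"
  unfolding power2_norm_eq_inner
  by (simp add: inner_diff_left inner_diff_right inner_commute power2_eq_square algebra_simps)

text \<open>Both sides are twice the weighted variance. The free centre \<open>z\<close> is used
  below once at the barycentre and once at the origin.\<close>

lemma weighted_pairwise_distances:
  fixes v :: "'i \<Rightarrow> 'a::real_inner" and w :: "'i \<Rightarrow> real"
  assumes w1: "sum w I = 1"
  shows "(\<Sum>i\<in>I. \<Sum>j\<in>I. w i * w j * (norm (v i - v j))\<^sup>2) =
      2 * (\<Sum>i\<in>I. w i * (norm (v i - z))\<^sup>2) - 2 * (norm ((\<Sum>i\<in>I. w i *\<^sub>R v i) - z))\<^sup>2"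
proof -
  define a where "a i = w i * (norm (v i - z))\<^sup>2" for i
  define b where "b i = w i *\<^sub>R (v i - z)" for i
  have s: "(\<Sum>i\<in>I. w i *\<^sub>R v i) - z = sum b I"
    using w1 by (simp add: b_def scaleR_diff_right sum_subtractf flip: scaleR_left.sum)
  have "w i * w j * (norm (v i - v j))\<^sup>2 = a i * w j + w i * a j - 2 * (b i \<bullet> b j)" for i j
  proof -
    have "(norm (v i - v j))\<^sup>2 = (norm (v i - z))\<^sup>2 + (norm (v j - z))\<^sup>2 - 2 * ((v i - z) \<bullet> (v j - z))"
      using norm_diff_scaleR_power2[of "v i - z" 1 "v j - z"] by simp
    then show ?thesis
      unfolding a_def b_def inner_scaleR_left inner_scaleR_right by algebra
  qed
  then have "(\<Sum>i\<in>I. \<Sum>j\<in>I. w i * w j * (norm (v i - v j))\<^sup>2) =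
      sum a I * sum w I + sum w I * sum a I - 2 * (sum b I \<bullet> sum b I)"
    unfolding sum_product inner_sum_left
    by (simp add: inner_sum_right sum.distrib sum_subtractf flip: sum_distrib_left)
  also have "\<dots> = 2 * sum a I - 2 * (norm (sum b I))\<^sup>2"
    by (simp add: w1 power2_norm_eq_inner)
  finally show ?thesis by (simp add: s a_def)
qed

text \<open>The non-expansive map from \<open>q i\<close> to \<open>u i\<close> is extended to the
  origin, with image \<open>c\<close>. The minimiser \<open>c\<close> of the largest excess
  \<open>g i\<close> lies in the hull of the points attaining it, and averaging the excesses with
  the weights of \<open>c\<close> shows that the largest one is at most 0.\<close>

lemma one_point_Kirszbraun:
  fixes u :: "'i \<Rightarrow> 'a::euclidean_space" and q :: "'i \<Rightarrow> 'b::real_inner"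
  assumes I: "finite I" "I \<noteq> {}"
    and le: "\<And>i j. i \<in> I \<Longrightarrow> j \<in> I \<Longrightarrow> norm (u i - u j) \<le> norm (q i - q j)"
  obtains c where "\<And>i. i \<in> I \<Longrightarrow> norm (u i - c) \<le> norm (q i)"
proof -
  define g where "g i x = (norm (u i - x))\<^sup>2 - (norm (q i))\<^sup>2" for i x
  define G where "G x = Max ((\<lambda>i. g i x) ` I)" for x
  define H where "H = convex hull (u ` I)"
  have "compact H" "H \<noteq> {}" using I by (simp_all add: H_def finite_imp_compact_convex_hull)
  moreover have cont: "continuous_on S (g i)" for i S
    unfolding g_def by (intro continuous_intros)
  have contG: "continuous_on H G"
    unfolding G_def using I
  proof (induction I rule: finite_ne_induct)
    case (insert i F)
    then have "Max ((\<lambda>i. g i x) ` insert i F) = max (g i x) (Max ((\<lambda>i. g i x) ` F))" for x by simp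
    then show ?case using insert cont by (auto intro!: continuous_intros)
  qed (use cont in auto)
  ultimately obtain c where c: "c \<in> H" "\<And>x. x \<in> H \<Longrightarrow> G c \<le> G x"
    using continuous_attains_inf[of H G] by blast
  have g_le: "g i x \<le> G x" if "i \<in> I" for i x
    using that I by (simp add: G_def)
  define J where "J = {i \<in> I. g i c = G c}"
  define K where "K = convex hull (u ` J)"
  have "G c \<in> (\<lambda>i. g i c) ` I" unfolding G_def using I by (intro Max_in) auto
  then have J: "J \<noteq> {}" "finite J" "J \<subseteq> I" using I by (auto simp: J_def)
  have K: "convex K" "closed K" "K \<noteq> {}" "K \<subseteq> H"
    using J by (auto simp: K_def H_def compact_imp_closed finite_imp_compact_convex_hull intro!: hull_mono)
  \<comment> \<open>Otherwise a small move towards the nearest point of \<open>K\<close> lowers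
    every active excess to first order, while the inactive ones stay below the maximum by
    continuity.\<close>
  have "c \<in> K"
  proof (rule ccontr)
    assume "c \<notin> K"
    define p where "p = closest_point K c"
    have p: "p \<in> K" using K by (simp add: p_def closest_point_in_set)
    with \<open>c \<notin> K\<close> have "p \<noteq> c" by blast
    define x where "x e = c + e *\<^sub>R (p - c)" for e :: real
    have xH: "x e \<in> H" if "0 \<le> e" "e \<le> 1" for e
    proof -
      have "x e = (1 - e) *\<^sub>R c + e *\<^sub>R p" by (simp add: x_def algebra_simps)
      then show ?thesis
        using that p K(4) c(1) convexD_alt[of H c p e] by (auto simp: H_def)
    qed
    have "\<forall>\<^sub>F e in at_right 0. g i (x e) < G c" if i: "i \<in> I" for i
    proof (cases "i \<in> J")
      case True
      then have "u i \<in> K" by (simp add: K_def hull_inc)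
      then have "(c - p) \<bullet> (u i - p) \<le> 0"
        using closest_point_dot[of K "u i" c] K by (simp add: p_def)
      then have dot: "(u i - c) \<bullet> (p - c) \<ge> (norm (p - c))\<^sup>2"
        by (simp add: power2_norm_eq_inner inner_diff_left inner_diff_right inner_commute)
      have "g i (x e) < G c" if e: "0 < e" "e < 1" for e
      proof -
        have "g i (x e) = g i c - 2 * e * ((u i - c) \<bullet> (p - c)) + e\<^sup>2 * (norm (p - c))\<^sup>2"
          using norm_diff_scaleR_power2[of "u i - c" e "p - c"]
          by (simp add: g_def x_def diff_diff_eq)
        also have "\<dots> \<le> g i c - 2 * e * (norm (p - c))\<^sup>2 + e\<^sup>2 * (norm (p - c))\<^sup>2"
          using dot e by simp
        also have "\<dots> = g i c - e * (2 - e) * (norm (p - c))\<^sup>2"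
          by (simp add: algebra_simps power2_eq_square)
        also have "\<dots> < g i c" using e \<open>p \<noteq> c\<close> by simp
        finally show ?thesis using True by (simp add: J_def)
      qed
      then show ?thesis
        by (auto simp: eventually_at_right_field intro!: exI[of _ 1])
    next
      case False
      then have "g i c < G c" using g_le[OF i, of c] i by (auto simp: J_def)
      moreover have "((\<lambda>e. g i (x e)) \<longlongrightarrow> g i (x 0)) (at_right 0)"
        unfolding g_def x_def by (intro tendsto_intros)
      ultimately show ?thesis by (intro order_tendstoD) (auto simp: x_def)
    qed
    then have "\<forall>\<^sub>F e in at_right 0. \<forall>i\<in>I. g i (x e) < G c"
      using I by (simp add: eventually_ball_finite_distrib)
    moreover have "\<forall>\<^sub>F e in at_right (0::real). 0 < e \<and> e < 1"
      by (auto simp: eventually_at_right_field intro!: exI[of _ 1])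
    ultimately have "\<forall>\<^sub>F e in at_right (0::real). False"
    proof eventually_elim
      case (elim e)
      then have "G (x e) < G c" unfolding G_def[of "x e"] using I by simp
      with c(2)[OF xH[of e]] elim show False by simp
    qed
    then show False by (simp add: trivial_limit_at_right_real)
  qed
  then obtain k and w :: "nat \<Rightarrow> real" and y where
    w: "\<forall>i\<in>{1..k}. 0 \<le> w i \<and> y i \<in> u ` J" and w1: "sum w {1..k} = 1"
    and cy: "(\<Sum>i=1..k. w i *\<^sub>R y i) = c"
    unfolding K_def convex_hull_indexed by blast
  obtain \<iota> where \<iota>: "\<And>i. i \<in> {1..k} \<Longrightarrow> y i = u (\<iota> i) \<and> \<iota> i \<in> J"
  proof -
    have "\<forall>i\<in>{1..k}. \<exists>n. y i = u n \<and> n \<in> J" using w by blast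
    then show thesis using that by (metis (no_types))
  qed
  note var = weighted_pairwise_distances[OF w1]
  \<comment> \<open>For the \<open>u\<close> the barycentre is \<open>c\<close>, so the correction
    term of \<open>var\<close> vanishes; for the \<open>q\<close> about the origin it is merely
    dropped.\<close>
  have "2 * (\<Sum>i=1..k. w i * (norm (u (\<iota> i) - c))\<^sup>2) = (\<Sum>i=1..k. \<Sum>j=1..k. w i * w j * (norm (u (\<iota> i) - u (\<iota> j)))\<^sup>2)"
    using var[of "\<lambda>i. u (\<iota> i)" c] cy \<iota> by simp
  also have "\<dots> \<le> (\<Sum>i=1..k. \<Sum>j=1..k. w i * w j * (norm (q (\<iota> i) - q (\<iota> j)))\<^sup>2)"
  proof (intro sum_mono mult_left_mono power_mono)
    fix i j assume "i \<in> {1..k}" "j \<in> {1..k}"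
    then show "norm (u (\<iota> i) - u (\<iota> j)) \<le> norm (q (\<iota> i) - q (\<iota> j))" "0 \<le> w i * w j"
      using le J(3) \<iota> w by (blast, simp)
  qed simp
  also have "\<dots> \<le> 2 * (\<Sum>i=1..k. w i * (norm (q (\<iota> i)))\<^sup>2)"
    using var[of "\<lambda>i. q (\<iota> i)" 0] by simp
  finally have "(\<Sum>i=1..k. w i * g (\<iota> i) c) \<le> 0"
    by (simp add: g_def right_diff_distrib sum_subtractf)
  moreover have "(\<Sum>i=1..k. w i * g (\<iota> i) c) = (\<Sum>i=1..k. w i * G c)"
    using \<iota> by (intro sum.cong) (auto simp: J_def)
  ultimately have "G c \<le> 0" using w1 by (simp flip: sum_distrib_right)
  show thesis
  proof
    fix i assume "i \<in> I"
    then have "(norm (u i - c))\<^sup>2 \<le> (norm (q i))\<^sup>2"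
      using g_le[of i c] \<open>G c \<le> 0\<close> unfolding g_def by linarith
    then show "norm (u i - c) \<le> norm (q i)" by (rule power2_le_imp_le) simp
  qed
qed

text \<open>Points at distances \<open>t * r\<close> and \<open>t * s\<close> from the origin, 120
  degrees apart, have squared distance t^2 (r^2 + r s + s^2). The least \<open>t > 0\<close> making
  this at least (r + s)^2 for all radii is 2 / sqrt 3, forced by r = s.\<close>

lemma pairwise_intersecting_discs:
  fixes u :: "'i \<Rightarrow> point" and r :: "'i \<Rightarrow> real"
  assumes "finite I" and "I \<noteq> {}"
    and meet: "\<And>i j. i \<in> I \<Longrightarrow> j \<in> I \<Longrightarrow> norm (u i - u j) \<le> r i + r j"
  obtains c where "\<And>i. i \<in> I \<Longrightarrow> norm (u i - c) \<le> 2 / sqrt 3 * r i"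
proof -
  have r0: "0 \<le> r i" if "i \<in> I" for i
    using meet[OF that that] by simp
  define e where "e n = (if n = 0 then 1 else if n = 1 then Complex (- 1 / 2) (sqrt 3 / 2)
    else Complex (- 1 / 2) (- sqrt 3 / 2))" for n :: nat
  have e: "e m \<bullet> e n = (if m = n then 1 else - 1 / 2)" if "m \<in> {0,1,2}" "n \<in> {0,1,2}" for m n
    using that by (auto simp: e_def inner_complex_def)
  have "(\<Inter>i\<in>I. cball (u i) (2 / sqrt 3 * r i)) \<noteq> {}"
  proof (rule Helly_plane_indexed[OF assms(1,2)])
    fix i j k assume ijk: "i \<in> I" "j \<in> I" "k \<in> I"
    \<comment> \<open>Positions 0, 1, 2 label the model points, since \<open>i\<close>,
      \<open>j\<close>, \<open>k\<close> may coincide.\<close>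
    define f where "f n = (if n = 0 then i else if n = 1 then j else k)" for n :: nat
    have fI: "f n \<in> I" for n using ijk by (simp add: f_def)
    define q where "q n = (2 / sqrt 3 * r (f n)) *\<^sub>R e n" for n
    have "norm (u (f m) - u (f n)) \<le> norm (q m - q n)" if mn: "m \<in> {0,1,2}" "n \<in> {0,1,2}" for m n
    proof (cases "m = n")
      case False
      have "(norm (q m - q n))\<^sup>2 = (q m - q n) \<bullet> (q m - q n)"
        by (rule power2_norm_eq_inner)
      also have "\<dots> = 4 / 3 * ((r (f m))\<^sup>2 + (r (f n))\<^sup>2 + r (f m) * r (f n))"
      proof -
        have "e m \<bullet> e m = 1" "e n \<bullet> e n = 1" "e m \<bullet> e n = - 1 / 2" "e n \<bullet> e m = - 1 / 2"
          using e[of m m] e[of n n] e[of m n] e[of n m] mn False by simp_all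
        note E = this
        show ?thesis
          unfolding q_def inner_diff_left inner_diff_right inner_scaleR_left inner_scaleR_right E
          by (simp add: power2_eq_square field_simps)
      qed
      also have "\<dots> = (r (f m) + r (f n))\<^sup>2 + (r (f m) - r (f n))\<^sup>2 / 3"
        by (simp add: power2_eq_square field_simps)
      finally have "(r (f m) + r (f n))\<^sup>2 \<le> (norm (q m - q n))\<^sup>2" by simp
      then have "r (f m) + r (f n) \<le> norm (q m - q n)" by (rule power2_le_imp_le) simp
      with meet[OF fI[of m] fI[of n]] show ?thesis by linarith
    qed simp
    then obtain c where c: "\<And>n. n \<in> {0,1,2} \<Longrightarrow> norm (u (f n) - c) \<le> norm (q n)"
      using one_point_Kirszbraun[of "{0,1,2::nat}" "\<lambda>n. u (f n)" q] by auto
    have "norm (q n) = 2 / sqrt 3 * r (f n)" if "n \<in> {0,1,2}" for n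
      using e[OF that that] r0[OF fI] by (simp add: q_def norm_eq_sqrt_inner[of "e n"])
    then have "c \<in> cball (u (f n)) (2 / sqrt 3 * r (f n))" if "n \<in> {0,1,2}" for n
      using c[OF that] that by (simp add: dist_norm)
    from this[of 0] this[of 1] this[of 2]
    show "cball (u i) (2 / sqrt 3 * r i) \<inter> cball (u j) (2 / sqrt 3 * r j) \<inter> cball (u k) (2 / sqrt 3 * r k) \<noteq> {}"
      by (auto simp: f_def)
  qed simp
  then obtain c where "\<forall>i\<in>I. c \<in> cball (u i) (2 / sqrt 3 * r i)" by auto
  then have "norm (u i - c) \<le> 2 / sqrt 3 * r i" if "i \<in> I" for i
    using that by (simp add: dist_norm)
  then show thesis by (rule that)
qed

lemma convex_ellipse: "convex {x::'a::real_normed_vector. norm (a - x) + norm (b - x) \<le> k}"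
proof -
  have "convex_on UNIV (\<lambda>x. dist a x + dist b x)"
    by (intro convex_on_add convex_on_dist) simp_all
  note f = this[unfolded convex_on_def dist_norm]
  show ?thesis
  proof (intro convexI)
    fix x y :: 'a and s t :: real
    assume st: "0 \<le> s" "0 \<le> t" "s + t = 1"
      and xy: "x \<in> {x. norm (a - x) + norm (b - x) \<le> k}" "y \<in> {x. norm (a - x) + norm (b - x) \<le> k}"
    have "norm (a - (s *\<^sub>R x + t *\<^sub>R y)) + norm (b - (s *\<^sub>R x + t *\<^sub>R y))
        \<le> s * (norm (a - x) + norm (b - x)) + t * (norm (a - y) + norm (b - y))"
      using f st by blast
    also have "\<dots> \<le> k" using xy st by (intro convex_bound_le) auto
    finally show "s *\<^sub>R x + t *\<^sub>R y \<in> {x. norm (a - x) + norm (b - x) \<le> k}" by simp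
  qed
qed

section \<open>Crossing segments between two triples of points\<close>

text \<open>Twice the signed area of the triangle \<open>p q r\<close>.\<close>

definition orient :: "point \<Rightarrow> point \<Rightarrow> point \<Rightarrow> real" where
  "orient p q r = (q$1 - p$1) * (r$2 - p$2) - (q$2 - p$2) * (r$1 - p$1)"

lemma norm_add_le_crossing:
  fixes p q r s z :: "'a::euclidean_space"
  assumes "z \<in> closed_segment p r" and "z \<in> closed_segment q s"
  shows "norm (p - q) + norm (r - s) \<le> norm (p - r) + norm (q - s)"
proof -
  have "dist p r = dist p z + dist z r" "dist q s = dist q z + dist z s"
    using assms by (simp_all add: between flip: between_mem_segment)
  then show ?thesis
    using dist_triangle[of p q z] dist_triangle[of r s z]
    by (simp add: dist_commute flip: dist_norm)
qed

lemma balanced_combination_segments: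
  fixes p q r s :: "'a::real_vector"
  assumes "a > 0" "b > 0" "c > 0" "d > 0" "a + b = c + d"
    and "a *\<^sub>R p + b *\<^sub>R r = c *\<^sub>R q + d *\<^sub>R s"
  obtains z where "z \<in> closed_segment p r" and "z \<in> closed_segment q s"
proof
  define z where "z = (1 / (a + b)) *\<^sub>R (a *\<^sub>R p + b *\<^sub>R r)"
  have "1 - b / (a + b) = a / (a + b)" "1 - d / (a + b) = c / (a + b)"
    using assms(1-5) by (simp_all add: field_simps)
  then have "z = (1 - b / (a + b)) *\<^sub>R p + (b / (a + b)) *\<^sub>R r"
      "z = (1 - d / (a + b)) *\<^sub>R q + (d / (a + b)) *\<^sub>R s"
    by (simp add: z_def scaleR_add_right, simp add: z_def assms(6) scaleR_add_right)
  moreover have "b / (a + b) \<in> {0..1}" "d / (a + b) \<in> {0..1}"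
    using assms(1-5) by auto
  ultimately show "z \<in> closed_segment p r" "z \<in> closed_segment q s"
    unfolding in_segment by fastforce+
qed

text \<open>\<open>S\<close> and \<open>V\<close> form the affine dependence of the four points. By
  the hypotheses \<open>p\<close> and \<open>q\<close> enter it with opposite signs, and so do
  \<open>r\<close> and \<open>s\<close>; hence its Radon partition pairs \<open>p\<close> with
  \<open>r\<close> or with \<open>s\<close>, and the two segments of that pairing cross.\<close>

lemma orient_not_separated_imp:
  assumes A: "orient p r s * orient q r s > 0" and B: "orient r p q * orient s p q > 0"
  shows "norm (p - q) + norm (r - s) \<le> norm (p - r) + norm (q - s) \<or>
         norm (p - q) + norm (r - s) \<le> norm (p - s) + norm (q - r)"
proof -
  have S: "orient q r s + orient s p q = orient p r s + orient r p q"
    by (simp add: orient_def algebra_simps)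
  have V: "orient q r s *\<^sub>R p + orient s p q *\<^sub>R r = orient p r s *\<^sub>R q + orient r p q *\<^sub>R s"
    by (simp add: vec_eq_iff forall_2 orient_def algebra_simps)
  consider "orient p r s > 0" "orient q r s > 0" "orient r p q > 0" "orient s p q > 0"
    | "orient p r s > 0" "orient q r s > 0" "orient r p q < 0" "orient s p q < 0"
    | "orient p r s < 0" "orient q r s < 0" "orient r p q > 0" "orient s p q > 0"
    | "orient p r s < 0" "orient q r s < 0" "orient r p q < 0" "orient s p q < 0"
    using A B by (auto simp: zero_less_mult_iff)
  then show ?thesis
  proof cases
    case 1
    from balanced_combination_segments[OF 1(2,4,1,3) S V] norm_add_le_crossing show ?thesis by metis
  next
    case 2
    have "orient q r s *\<^sub>R p + (- orient r p q) *\<^sub>R s = orient p r s *\<^sub>R q + (- orient s p q) *\<^sub>R r"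
      using V by (simp add: algebra_simps)
    then obtain z where "z \<in> closed_segment p s" "z \<in> closed_segment q r"
      using balanced_combination_segments[of "orient q r s" "- orient r p q" "orient p r s" "- orient s p q" p s q r] 2 S
      by auto
    then show ?thesis using norm_add_le_crossing[of z p s q r] by (simp add: norm_minus_commute)
  next
    case 3
    have "(- orient q r s) *\<^sub>R p + orient r p q *\<^sub>R s = (- orient p r s) *\<^sub>R q + orient s p q *\<^sub>R r"
      using V by (simp add: algebra_simps)
    then obtain z where "z \<in> closed_segment p s" "z \<in> closed_segment q r"
      using balanced_combination_segments[of "- orient q r s" "orient r p q" "- orient p r s" "orient s p q" p s q r] 3 S
      by auto
    then show ?thesis using norm_add_le_crossing[of z p s q r] by (simp add: norm_minus_commute)
  next
    case 4
    have "(- orient q r s) *\<^sub>R p + (- orient s p q) *\<^sub>R r = (- orient p r s) *\<^sub>R q + (- orient r p q) *\<^sub>R s"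
      using V by (simp add: algebra_simps)
    then obtain z where "z \<in> closed_segment p r" "z \<in> closed_segment q s"
      using balanced_combination_segments[of "- orient q r s" "- orient s p q" "- orient p r s" "- orient r p q" p r q s] 4 S
      by auto
    then show ?thesis using norm_add_le_crossing[of z p r q s] by simp
  qed
qed

text \<open>Boolean core of \<open>sign_parity\<close>, each number replaced by its sign: a 2x2
  minor has a known sign when its two products have opposite signs, and three numbers cannot all
  have the sign opposite to their sum.\<close>

lemma sign_pattern_parity:
  fixes p1 p2 p3 q1 q2 q3 b1 b2 b3 D :: bool
  assumes "p2 = q3 \<and> p3 \<noteq> q2 \<longrightarrow> b1 = D" "p2 \<noteq> q3 \<and> p3 = q2 \<longrightarrow> b1 \<noteq> D"
    and "p3 = q1 \<and> p1 \<noteq> q3 \<longrightarrow> b2 = D" "p3 \<noteq> q1 \<and> p1 = q3 \<longrightarrow> b2 \<noteq> D"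
    and "p1 = q2 \<and> p2 \<noteq> q1 \<longrightarrow> b3 = D" "p1 \<noteq> q2 \<and> p2 = q1 \<longrightarrow> b3 \<noteq> D"
    and "\<not> (p1 = p2 \<and> p2 = p3 \<and> p3 \<noteq> D)" "\<not> (q1 = q2 \<and> q2 = q3 \<and> q3 \<noteq> D)"
  shows "((p1 \<noteq> q1 \<and> b2 \<noteq> b3) \<noteq> ((p2 \<noteq> q2 \<and> b3 \<noteq> b1) \<noteq> (p3 \<noteq> q3 \<and> b1 \<noteq> b2))) \<longleftrightarrow>
    ((p1 = p2 \<and> p2 = p3) \<noteq> (q1 = q2 \<and> q2 = q3))"
  using assms by argo

text \<open>
  With \<open>p\<close> and \<open>q\<close> the unnormalised barycentric coordinates of two points \<open>P\<close>, \<open>Q\<close> with respect to a triangle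
  and \<open>b\<close> the orientations of its vertices relative to the line \<open>PQ\<close>, this says that the segment \<open>PQ\<close> crosses
  the boundary of the triangle an odd number of times iff exactly one of \<open>P\<close>, \<open>Q\<close> lies inside.
\<close>

lemma sign_parity:
  fixes p1 p2 p3 q1 q2 q3 b1 b2 b3 D :: real
  assumes nz: "p1 \<noteq> 0" "p2 \<noteq> 0" "p3 \<noteq> 0" "q1 \<noteq> 0" "q2 \<noteq> 0" "q3 \<noteq> 0" "b1 \<noteq> 0" "b2 \<noteq> 0" "b3 \<noteq> 0" "D \<noteq> 0"
    and sum: "p1 + p2 + p3 = D" "q1 + q2 + q3 = D"
    and minors: "p2 * q3 - p3 * q2 = b1 * D" "p3 * q1 - p1 * q3 = b2 * D" "p1 * q2 - p2 * q1 = b3 * D"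
  shows "((((p1 > 0) \<noteq> (q1 > 0)) \<and> ((b2 > 0) \<noteq> (b3 > 0))) \<noteq>
          ((((p2 > 0) \<noteq> (q2 > 0)) \<and> ((b3 > 0) \<noteq> (b1 > 0))) \<noteq>
           (((p3 > 0) \<noteq> (q3 > 0)) \<and> ((b1 > 0) \<noteq> (b2 > 0))))) \<longleftrightarrow>
         ((((p1 > 0) = (p2 > 0)) \<and> ((p2 > 0) = (p3 > 0))) \<noteq>
          (((q1 > 0) = (q2 > 0)) \<and> ((q2 > 0) = (q3 > 0))))"
proof -
  have sg: "(x * y > 0) = ((x > 0) = (y > 0))" "(x * y < 0) = ((x > 0) \<noteq> (y > 0))"
    if "x \<noteq> 0" "y \<noteq> 0" for x y :: real
    using that by (auto simp: zero_less_mult_iff mult_less_0_iff)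
  have pos: "(x > 0) = (y > 0) \<and> (x' > 0) \<noteq> (y' > 0) \<longrightarrow> (b > 0) = (D > 0)"
    and neg: "(x > 0) \<noteq> (y > 0) \<and> (x' > 0) = (y' > 0) \<longrightarrow> (b > 0) \<noteq> (D > 0)"
    if "x * y - x' * y' = b * D" "x \<noteq> 0" "y \<noteq> 0" "x' \<noteq> 0" "y' \<noteq> 0" "b \<noteq> 0" for x y x' y' b :: real
    unfolding sg[OF that(2,3), symmetric] sg[OF that(4,5), symmetric] sg[OF that(6) \<open>D \<noteq> 0\<close>, symmetric]
    using that(1) by (simp_all flip: that(1))
  have not_opposite: "\<not> ((x > 0) = (y > 0) \<and> (y > 0) = (z > 0) \<and> (z > 0) \<noteq> (D > 0))"
    if "x + y + z = D" "x \<noteq> 0" "y \<noteq> 0" "z \<noteq> 0" for x y z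
    using that by linarith
  show ?thesis
    using pos[OF minors(1) nz(2,6,3,5,7)] neg[OF minors(1) nz(2,6,3,5,7)]
      pos[OF minors(2) nz(3,4,1,6,8)] neg[OF minors(2) nz(3,4,1,6,8)]
      pos[OF minors(3) nz(1,5,2,4,9)] neg[OF minors(3) nz(1,5,2,4,9)]
      not_opposite[OF sum(1) nz(1-3)] not_opposite[OF sum(2) nz(4-6)]
    by (rule sign_pattern_parity)
qed

text \<open>When \<open>s\<close> or \<open>t\<close> holds, an odd number of \<open>s\<close>,
  \<open>t\<close> and their conjunction hold. In the sum over the three pairs the \<open>t\<close>,
  being differences around a cycle, cancel.\<close>

lemma cover_parity:
  fixes s0 s1 s2 b0 b1 b2 I K :: bool
  assumes "s0 \<or> b1 \<noteq> b2" "s1 \<or> b2 \<noteq> b0" "s2 \<or> b0 \<noteq> b1"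
    and "((s0 \<and> b1 \<noteq> b2) \<noteq> ((s1 \<and> b2 \<noteq> b0) \<noteq> (s2 \<and> b0 \<noteq> b1))) \<longleftrightarrow> (I \<noteq> K)"
  shows "(s0 \<noteq> (s1 \<noteq> s2)) = (I = K)"
  using assms by (cases s0; cases s1; cases s2; cases b0; cases b1; cases b2; simp)

lemma eventually_orient_nonzero:
  assumes "orient p' q' r' \<noteq> 0"
  shows "\<forall>\<^sub>F t in at_right 0. orient (p + t *\<^sub>R p') (q + t *\<^sub>R q') (r + t *\<^sub>R r') \<noteq> 0"
proof -
  define c1 where "c1 = (q'$1 - p'$1) * (r$2 - p$2) + (q$1 - p$1) * (r'$2 - p'$2)
    - (q'$2 - p'$2) * (r$1 - p$1) - (q$2 - p$2) * (r'$1 - p'$1)"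
  \<comment> \<open>The leading coefficient is nonzero by assumption, so there are finitely many
    roots; a root at 0 is harmless because only \<open>t > 0\<close> counts.\<close>
  define P where "P = [:orient p q r, c1, orient p' q' r':]"
  have P: "orient (p + t *\<^sub>R p') (q + t *\<^sub>R q') (r + t *\<^sub>R r') = poly P t" for t
    by (simp add: P_def c1_def orient_def algebra_simps power2_eq_square)
  have "P \<noteq> 0" using assms by (simp add: P_def)
  then have "finite {t. poly P t = 0}" by (rule poly_roots_finite)
  then have "closed ({t. poly P t = 0} - {0})" by (simp add: finite_imp_closed)
  then have "\<forall>\<^sub>F t in nhds 0. t \<in> - ({t. poly P t = 0} - {0})"
    by (intro eventually_nhds_in_open open_Compl) auto
  then have "\<forall>\<^sub>F t in at_right 0. t \<in> - ({t. poly P t = 0} - {0})"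
    unfolding eventually_at_filter by (rule eventually_mono) auto
  moreover have "\<forall>\<^sub>F t in at_right 0. t > (0::real)"
    by (simp add: eventually_at_right_less)
  ultimately show ?thesis
    by eventually_elim (auto simp: P)
qed

lemma eventually_perturbed_norm_less:
  fixes p q r s :: "'a::real_normed_vector"
  assumes "norm (p - r) + norm (q - s) < norm (p - q) + norm (r - s)"
  shows "\<forall>\<^sub>F t in at_right (0::real).
    norm ((p + t *\<^sub>R p') - (r + t *\<^sub>R r')) + norm ((q + t *\<^sub>R q') - (s + t *\<^sub>R s'))
    < norm ((p + t *\<^sub>R p') - (q + t *\<^sub>R q')) + norm ((r + t *\<^sub>R r') - (s + t *\<^sub>R s'))"
proof -
  let ?f = "\<lambda>t. norm ((p + t *\<^sub>R p') - (r + t *\<^sub>R r')) + norm ((q + t *\<^sub>R q') - (s + t *\<^sub>R s'))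
    - (norm ((p + t *\<^sub>R p') - (q + t *\<^sub>R q')) + norm ((r + t *\<^sub>R r') - (s + t *\<^sub>R s')))"
  have "(?f \<longlongrightarrow> ?f 0) (at_right 0)"
    by (intro tendsto_intros)
  moreover have "?f 0 < 0" using assms by simp
  ultimately have "\<forall>\<^sub>F t in at_right 0. ?f t < 0" by (rule order_tendstoD)
  then show ?thesis by (rule eventually_mono) simp
qed

text \<open>
  If no two disjoint segments cross, then for all pairs \<open>i \<noteq> k\<close> and \<open>j \<noteq> l\<close> the line \<open>U j U l\<close> separates
  \<open>X i\<close>, \<open>X k\<close> or the line \<open>X i X k\<close> separates \<open>U j\<close>, \<open>U l\<close>, and both happen iff the sides \<open>X i X k\<close> and \<open>U j U l\<close> cross.
  Each line separates 0 or 2 of the three pairs, so the total number of separations is even; but it equals 9 plus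
  the number of crossings of the boundaries of the two triangles, which is even.
\<close>

lemma bipartite_segments_cross_general_position:
  fixes X U :: "nat \<Rightarrow> point"
  assumes DU: "orient (U 0) (U 1) (U 2) \<noteq> 0"
    and XU: "\<And>i j l. i < 3 \<Longrightarrow> j < 3 \<Longrightarrow> l < 3 \<Longrightarrow> j \<noteq> l \<Longrightarrow> orient (X i) (U j) (U l) \<noteq> 0"
    and UX: "\<And>j i k. j < 3 \<Longrightarrow> i < 3 \<Longrightarrow> k < 3 \<Longrightarrow> i \<noteq> k \<Longrightarrow> orient (U j) (X i) (X k) \<noteq> 0"
  shows "\<exists>i<3. \<exists>k<3. \<exists>j<3. \<exists>l<3. i \<noteq> k \<and> j \<noteq> l \<and>
    norm (X i - X k) + norm (U j - U l) \<le> norm (X i - U j) + norm (X k - U l)"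
proof (rule ccontr)
  assume neg: "\<not> ?thesis"
  define s where "s m = Suc m mod 3" for m
  define s2 where "s2 m = Suc (Suc m) mod 3" for m
  \<comment> \<open>\<open>A i n\<close> is the unnormalised barycentric coordinate of
    \<open>X i\<close> at the vertex \<open>U n\<close>; the sign of \<open>B j m\<close> is the
    side of \<open>U j\<close> relative to the line opposite \<open>X m\<close>.\<close>
  define A where "A i n = orient (X i) (U (s n)) (U (s2 n))" for i n
  define B where "B j m = orient (U j) (X (s m)) (X (s2 m))" for j m
  have sv: "s 0 = 1" "s2 0 = 2" "s 1 = 2" "s2 1 = 0" "s 2 = 0" "s2 2 = 1"
    by (simp_all add: s_def s2_def)
  have lt: "s m < 3" "s2 m < 3" for m by (simp_all add: s_def s2_def)
  have ne: "s m \<noteq> s2 m" if "m \<in> {0,1,2}" for m using that by (auto simp: s_def s2_def)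
  have A0: "A i n \<noteq> 0" if "i < 3" "n \<in> {0,1,2}" for i n
    using XU that ne lt by (simp add: A_def)
  have B0: "B j m \<noteq> 0" if "j < 3" "m \<in> {0,1,2}" for j m
    using UX that ne lt by (simp add: B_def)
  have cover: "(A (s m) n > 0) \<noteq> (A (s2 m) n > 0) \<or> (B (s n) m > 0) \<noteq> (B (s2 n) m > 0)"
    if mn: "m \<in> {0,1,2}" "n \<in> {0,1,2}" for m n
  proof (rule ccontr)
    assume "\<not> ?thesis"
    then have "A (s m) n * A (s2 m) n > 0" "B (s n) m * B (s2 n) m > 0"
      using A0[OF lt(1) mn(2), of m] A0[OF lt(2) mn(2), of m] B0[OF lt(1) mn(1), of n] B0[OF lt(2) mn(1), of n]
      by (auto simp: zero_less_mult_iff)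
    then have "norm (X (s m) - X (s2 m)) + norm (U (s n) - U (s2 n)) \<le> norm (X (s m) - U (s n)) + norm (X (s2 m) - U (s2 n)) \<or>
      norm (X (s m) - X (s2 m)) + norm (U (s n) - U (s2 n)) \<le> norm (X (s m) - U (s2 n)) + norm (X (s2 m) - U (s n))"
      unfolding A_def B_def by (rule orient_not_separated_imp)
    then show False
      using neg lt ne[OF mn(1)] ne[OF mn(2)] by (metis norm_minus_commute)
  qed
  have par: "(((A (s m) 0 > 0) \<noteq> (A (s2 m) 0 > 0) \<and> (B 1 m > 0) \<noteq> (B 2 m > 0)) \<noteq>
     (((A (s m) 1 > 0) \<noteq> (A (s2 m) 1 > 0) \<and> (B 2 m > 0) \<noteq> (B 0 m > 0)) \<noteq>
      ((A (s m) 2 > 0) \<noteq> (A (s2 m) 2 > 0) \<and> (B 0 m > 0) \<noteq> (B 1 m > 0)))) \<longleftrightarrow>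
      (((A (s m) 0 > 0) = (A (s m) 1 > 0) \<and> (A (s m) 1 > 0) = (A (s m) 2 > 0)) \<noteq>
       ((A (s2 m) 0 > 0) = (A (s2 m) 1 > 0) \<and> (A (s2 m) 1 > 0) = (A (s2 m) 2 > 0)))"
    if m: "m \<in> {0,1,2}" for m
  proof (rule sign_parity[where D = "orient (U 0) (U 1) (U 2)"])
    have O: "orient x u v + orient x v w + orient x w u = orient u v w" for x u v w
      by (simp add: orient_def algebra_simps)
    \<comment> \<open>Three-term Pluecker relation for the vectors from \<open>u\<close> to the
      other four points; it supplies the minors for \<open>sign_parity\<close>.\<close>
    have O2: "orient p w u * orient q u v - orient p u v * orient q w u = orient u p q * orient u v w" for p q u v w
      by (simp add: orient_def algebra_simps)
    have O3: "orient u v w = orient v w u" for u v w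
      by (simp add: orient_def algebra_simps)
    show "A (s m) 0 + A (s m) 1 + A (s m) 2 = orient (U 0) (U 1) (U 2)"
        "A (s2 m) 0 + A (s2 m) 1 + A (s2 m) 2 = orient (U 0) (U 1) (U 2)"
      unfolding A_def sv using O[of _ "U 0" "U 1" "U 2"] by (simp_all add: algebra_simps)
    show "A (s m) 1 * A (s2 m) 2 - A (s m) 2 * A (s2 m) 1 = B 0 m * orient (U 0) (U 1) (U 2)"
      unfolding A_def B_def sv by (rule O2)
    show "A (s m) 2 * A (s2 m) 0 - A (s m) 0 * A (s2 m) 2 = B 1 m * orient (U 0) (U 1) (U 2)"
      unfolding A_def B_def sv by (subst O3, rule O2)
    show "A (s m) 0 * A (s2 m) 1 - A (s m) 1 * A (s2 m) 0 = B 2 m * orient (U 0) (U 1) (U 2)"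
      unfolding A_def B_def sv O3[of "U 0" "U 1" "U 2"] by (subst O3, rule O2)
  qed (use A0 B0 lt m DU in auto)
  \<comment> \<open>\<open>I i\<close> says that \<open>X i\<close> lies inside the triangle
    \<open>U\<close>, \<open>Z i\<close> that an odd number of its coordinates are positive.\<close>
  define I where "I i \<longleftrightarrow> (A i 0 > 0) = (A i 1 > 0) \<and> (A i 1 > 0) = (A i 2 > 0)" for i
  define Z where "Z i \<longleftrightarrow> (A i 0 > 0) \<noteq> ((A i 1 > 0) \<noteq> (A i 2 > 0))" for i
  have xor: "((x0 \<noteq> y0) \<noteq> ((x1 \<noteq> y1) \<noteq> (x2 \<noteq> y2))) = ((x0 \<noteq> (x1 \<noteq> x2)) \<noteq> (y0 \<noteq> (y1 \<noteq> y2)))"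
    for x0 x1 x2 y0 y1 y2 :: bool by blast
  \<comment> \<open>Around the three sides both \<open>Z\<close> and \<open>I\<close> change an even
    number of times, so \<open>I\<close> agrees an odd number of times: a contradiction.\<close>
  have "(Z (s m) \<noteq> Z (s2 m)) = (I (s m) = I (s2 m))" if m: "m \<in> {0,1,2}" for m
    using cover_parity[OF _ _ _ par[OF m]] cover[OF m, of 0] cover[OF m, of 1] cover[OF m, of 2]
    unfolding Z_def I_def xor sv by blast
  from this[of 0] this[of 1] this[of 2] show False unfolding sv by blast
qed

text \<open>Under the negated claim all inequalities are strict and survive small perturbations.
  Since no three points of a parabola are collinear, moving the six points in directions taken from
  it reaches general position.\<close>

lemma bipartite_segments_cross:
  fixes X U :: "nat \<Rightarrow> point"
  shows "\<exists>i<3. \<exists>k<3. \<exists>j<3. \<exists>l<3. i \<noteq> k \<and> j \<noteq> l \<and>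
    norm (X i - X k) + norm (U j - U l) \<le> norm (X i - U j) + norm (X k - U l)"
proof (rule ccontr)
  assume neg: "\<not> ?thesis"
  define q :: "real \<Rightarrow> point" where "q x = vector [x, x\<^sup>2]" for x
  have orient_q: "orient (q x) (q y) (q z) = (y - x) * (z - x) * (z - y)" for x y z
    by (simp add: orient_def q_def power2_eq_square algebra_simps)
  define X' where "X' t i = X i + t *\<^sub>R q (real i)" for t i
  \<comment> \<open>The shift by 3 gives the six directions distinct parameters.\<close>
  define U' where "U' t j = U j + t *\<^sub>R q (real j + 3)" for t j
  have "\<forall>\<^sub>F t in at_right 0. orient (U' t 0) (U' t 1) (U' t 2) \<noteq> 0"
    unfolding U'_def by (rule eventually_orient_nonzero) (simp add: orient_q)
  moreover have "\<forall>\<^sub>F t in at_right 0. \<forall>i\<in>{..<3}. \<forall>j\<in>{..<3}. \<forall>l\<in>{..<3}. j \<noteq> l \<longrightarrow> orient (X' t i) (U' t j) (U' t l) \<noteq> 0"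
  proof (intro eventually_ball_finite ballI finite_lessThan)
    fix i j l :: nat
    assume "i \<in> {..<3}" "j \<in> {..<3}" "l \<in> {..<3}"
    then show "\<forall>\<^sub>F t in at_right 0. j \<noteq> l \<longrightarrow> orient (X' t i) (U' t j) (U' t l) \<noteq> 0"
      unfolding X'_def U'_def
      by (cases "j = l") (auto intro!: eventually_orient_nonzero simp: orient_q)
  qed
  moreover have "\<forall>\<^sub>F t in at_right 0. \<forall>j\<in>{..<3}. \<forall>i\<in>{..<3}. \<forall>k\<in>{..<3}. i \<noteq> k \<longrightarrow> orient (U' t j) (X' t i) (X' t k) \<noteq> 0"
  proof (intro eventually_ball_finite ballI finite_lessThan)
    fix i j k :: nat
    assume "i \<in> {..<3}" "j \<in> {..<3}" "k \<in> {..<3}"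
    then show "\<forall>\<^sub>F t in at_right 0. i \<noteq> k \<longrightarrow> orient (U' t j) (X' t i) (X' t k) \<noteq> 0"
      unfolding X'_def U'_def
      by (cases "i = k") (auto intro!: eventually_orient_nonzero simp: orient_q)
  qed
  moreover have "\<forall>\<^sub>F t in at_right 0. \<forall>i\<in>{..<3}. \<forall>k\<in>{..<3}. \<forall>j\<in>{..<3}. \<forall>l\<in>{..<3}. i \<noteq> k \<and> j \<noteq> l \<longrightarrow>
    norm (X' t i - U' t j) + norm (X' t k - U' t l) < norm (X' t i - X' t k) + norm (U' t j - U' t l)"
  proof (intro eventually_ball_finite ballI finite_lessThan)
    fix i k j l :: nat
    assume *: "i \<in> {..<3}" "k \<in> {..<3}" "j \<in> {..<3}" "l \<in> {..<3}"
    show "\<forall>\<^sub>F t in at_right 0. i \<noteq> k \<and> j \<noteq> l \<longrightarrow>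
      norm (X' t i - U' t j) + norm (X' t k - U' t l) < norm (X' t i - X' t k) + norm (U' t j - U' t l)"
    proof (cases "i \<noteq> k \<and> j \<noteq> l")
      case True
      then have "norm (X i - U j) + norm (X k - U l) < norm (X i - X k) + norm (U j - U l)"
        using neg * by (meson lessThan_iff not_le)
      from eventually_perturbed_norm_less[OF this] show ?thesis
        unfolding X'_def U'_def by (rule eventually_mono) blast
    qed auto
  qed
  ultimately have "\<forall>\<^sub>F t in at_right (0::real). False"
  proof eventually_elim
    case (elim t)
    have "\<exists>i<3. \<exists>k<3. \<exists>j<3. \<exists>l<3. i \<noteq> k \<and> j \<noteq> l \<and>
        norm (X' t i - X' t k) + norm (U' t j - U' t l) \<le> norm (X' t i - U' t j) + norm (X' t k - U' t l)"
      by (rule bipartite_segments_cross_general_position) (use elim in auto)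
    then show False
      using elim(4) by (meson lessThan_iff not_le)
  qed
  then show False by (simp add: trivial_limit_at_right_real)
qed

section \<open>Existence of the radii\<close>

text \<open>The ends of an edge get half its length plus or minus one unknown as radii, so tangency
  is automatic.\<close>

definition sgnb :: "bool \<Rightarrow> real" where
  "sgnb x = (if x then 1 else - 1)"

lemma real_between_lists:
  fixes L U :: "real list"
  assumes "L \<noteq> []" and "\<forall>l\<in>set L. \<forall>u\<in>set U. l \<le> u"
  obtains z where "\<forall>l\<in>set L. l \<le> z" and "\<forall>u\<in>set U. z \<le> u"
proof
  show "\<forall>l\<in>set L. l \<le> Max (set L)" by simp
  show "\<forall>u\<in>set U. Max (set L) \<le> u" using assms by simp
qed

text \<open>Fourier-Motzkin elimination of \<open>c\<close>, then \<open>b\<close>, then \<open>a\<close>; the hypotheses are the irreducible alternating cycles.\<close>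

lemma potential_system_solvable:
  fixes f g h :: "bool \<Rightarrow> bool \<Rightarrow> real"
  assumes f: "\<And>x y. f x y + f (\<not> x) (\<not> y) \<le> 0"
    and g: "\<And>x y. g x y + g (\<not> x) (\<not> y) \<le> 0"
    and h: "\<And>x y. h x y + h (\<not> x) (\<not> y) \<le> 0"
    and cyc: "\<And>x y z. f x y + g (\<not> y) z + h (\<not> x) (\<not> z) \<le> 0"
    and t1: "\<And>x. f x True + f x False + h (\<not> x) True + h (\<not> x) False \<le> 0"
    and t2: "\<And>x. f True x + f False x + g (\<not> x) True + g (\<not> x) False \<le> 0"
    and t3: "\<And>x. h True x + h False x + g True (\<not> x) + g False (\<not> x) \<le> 0"
  obtains a b c where "\<And>x y. f x y \<le> sgnb x * a + sgnb y * b"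
    and "\<And>x y. g x y \<le> sgnb x * b + sgnb y * c"
    and "\<And>x y. h x y \<le> sgnb x * a + sgnb y * c"
proof -
  define fpp fpm fmp fmm where "fpp = f True True" "fpm = f True False" "fmp = f False True" "fmm = f False False"
  define gpp gpm gmp gmm where "gpp = g True True" "gpm = g True False" "gmp = g False True" "gmm = g False False"
  define hpp hpm hmp hmm where "hpp = h True True" "hpm = h True False" "hmp = h False True" "hmm = h False False"
  note defs = fpp_fpm_fmp_fmm_def gpp_gpm_gmp_gmm_def hpp_hpm_hmp_hmm_def
  have F: "fpp + fmm \<le> 0" "fpm + fmp \<le> 0" "gpp + gmm \<le> 0" "gpm + gmp \<le> 0" "hpp + hmm \<le> 0" "hpm + hmp \<le> 0"
    using f[of True True] f[of True False] g[of True True] g[of True False] h[of True True] h[of True False]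
    by (simp_all add: defs)
  have C: "fpp + gmp + hmm \<le> 0" "fpp + gmm + hmp \<le> 0" "fpm + gpp + hmm \<le> 0" "fpm + gpm + hmp \<le> 0"
      "fmp + gmp + hpm \<le> 0" "fmp + gmm + hpp \<le> 0" "fmm + gpp + hpm \<le> 0" "fmm + gpm + hpp \<le> 0"
    using cyc[of True True True] cyc[of True True False] cyc[of True False True] cyc[of True False False]
      cyc[of False True True] cyc[of False True False] cyc[of False False True] cyc[of False False False]
    by (simp_all add: defs)
  have T: "fpp + fpm + hmp + hmm \<le> 0" "fmp + fmm + hpp + hpm \<le> 0" "fpp + fmp + gmp + gmm \<le> 0"
      "fpm + fmm + gpp + gpm \<le> 0" "hpp + hmp + gpm + gmm \<le> 0" "hpm + hmm + gpp + gmp \<le> 0"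
    using t1[of True] t1[of False] t2[of True] t2[of False] t3[of True] t3[of False] by (simp_all add: defs)
  note I = F C T
  \<comment> \<open>After eliminating \<open>c\<close>, the entries of \<open>ep y\<close> and \<open>em y\<close> are the lower bounds for \<open>a + sgnb y * b\<close> and \<open>- a + sgnb y * b\<close>.\<close>
  define ep where "ep = (\<lambda>y. if y then [fpp, hpp + gpm, hpm + gpp] else [fpm, hpp + gmm, hpm + gmp])"
  define em where "em = (\<lambda>y. if y then [fmp, hmp + gpm, hmm + gpp] else [fmm, hmp + gmm, hmm + gmp])"
  \<comment> \<open>Eliminating \<open>c\<close> from the bounds \<open>g\<close> alone leaves
    \<open>gp <= b\<close> and \<open>gm <= - b\<close>.\<close>
  define gp gm where "gp = (gpp + gpm) / 2" "gm = (gmp + gmm) / 2"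
  \<comment> \<open>Elimination of \<open>b\<close>: lower bounds for \<open>a\<close> (from
    \<open>ep\<close>) or \<open>- a\<close> (from \<open>em\<close>), using two entries with
    opposite signs of \<open>b\<close>, or one entry and \<open>gm\<close> or
    \<open>gp\<close>.\<close>
  define LL where "LL = (\<lambda>e. map (\<lambda>(s, t). (s + t) / 2) (List.product (e True) (e False)) 
    @ map (\<lambda>s. s + gm) (e True) @ map (\<lambda>s. s + gp) (e False))"
  define L where "L = (hpp + hpm) / 2 # LL ep"
  define U where "U = - ((hmp + hmm) / 2) # map uminus (LL em)"
  \<comment> \<open>In these pairs \<open>a\<close> and \<open>b\<close> cancel together.\<close>
  have E: "s + t \<le> 0" if "s \<in> set (ep True)" "t \<in> set (em False)" for s t
    using that I by (auto simp: ep_def em_def)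
  have E': "s + t \<le> 0" if "s \<in> set (em True)" "t \<in> set (ep False)" for s t
    using that I by (auto simp: ep_def em_def)
  have "\<forall>l\<in>set L. \<forall>u\<in>set U. l \<le> u"
    unfolding L_def U_def LL_def ep_def em_def gp_gm_def
    by (simp add: field_simps) (intro conjI; use I in linarith)
  moreover have "L \<noteq> []" by (simp add: L_def)
  ultimately obtain a where a: "\<forall>l\<in>set L. l \<le> a" "\<forall>u\<in>set U. a \<le> u"
    using real_between_lists by blast
  have a1: "hpp + hpm \<le> 2 * a" "hmp + hmm \<le> - 2 * a"
    using a by (auto simp: L_def U_def field_simps)
  have aL: "l \<le> a" if "l \<in> set (LL ep)" for l
    using a(1) that by (simp add: L_def)
  have aU: "l \<le> - a" if "l \<in> set (LL em)" for l
    using a(2) that by (fastforce simp: U_def)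
  have LL: "(s + t) / 2 \<in> set (LL e)" "s + gm \<in> set (LL e)" "t + gp \<in> set (LL e)"
    if "s \<in> set (e True)" "t \<in> set (e False)" for s t e
    using that by (auto simp: LL_def intro!: rev_image_eqI[of "(s, t)"])
  have ne: "\<exists>s. s \<in> set (ep x)" "\<exists>s. s \<in> set (em x)" for x
    by (auto simp: ep_def em_def)
  have a2: "s + t \<le> 2 * a" if "s \<in> set (ep True)" "t \<in> set (ep False)" for s t
    using aL[OF LL(1)[of _ ep]] that by fastforce
  have a3: "s + t \<le> - 2 * a" if "s \<in> set (em True)" "t \<in> set (em False)" for s t
    using aU[OF LL(1)[of _ em]] that by fastforce
  have a4: "s + gm \<le> a" if "s \<in> set (ep True)" for s
    using aL[OF LL(2)[of _ ep]] that ne by blast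
  have a5: "s + gp \<le> a" if "s \<in> set (ep False)" for s
    using aL[OF LL(3)[of _ ep]] that ne by blast
  have a6: "s + gm \<le> - a" if "s \<in> set (em True)" for s
    using aU[OF LL(2)[of _ em]] that ne by blast
  have a7: "s + gp \<le> - a" if "s \<in> set (em False)" for s
    using aU[OF LL(3)[of _ em]] that ne by blast
  \<comment> \<open>Back substitution: bounds for \<open>b\<close> once \<open>a\<close> is
    fixed.\<close>
  define L2 where "L2 = gp # map (\<lambda>s. s - a) (ep True) @ map (\<lambda>s. s + a) (em True)"
  define U2 where "U2 = -gm # map (\<lambda>s. a - s) (ep False) @ map (\<lambda>s. - a - s) (em False)"
  have "gp \<le> - gm" using I by (simp add: gp_gm_def field_simps)
  then have "\<forall>l\<in>set L2. \<forall>u\<in>set U2. l \<le> u"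
    by (auto simp: L2_def U2_def dest: a4 a5 a6 a7 a2 a3 E E')
  moreover have "L2 \<noteq> []" by (simp add: L2_def)
  ultimately obtain b where b: "\<forall>l\<in>set L2. l \<le> b" "\<forall>u\<in>set U2. b \<le> u"
    using real_between_lists by blast
  note b' = b[unfolded L2_def U2_def gp_gm_def ep_def em_def, simplified]
  have "b \<le> - gm" using b(2) by (simp add: U2_def)
  then have b'': "2 * b + gmp + gmm \<le> 0" by (simp add: gp_gm_def field_simps)
  define L3 U3 where "L3 = [hpp - a, hmp + a, gpp - b, gmp + b]" "U3 = [a - hpm, - a - hmm, b - gpm, - b - gmm]"
  have "\<forall>l\<in>set L3. \<forall>u\<in>set U3. l \<le> u"
    using I a1 b' b'' by (auto simp: L3_U3_def)
  moreover have "L3 \<noteq> []" by (simp add: L3_U3_def)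
  ultimately obtain c where c: "\<forall>l\<in>set L3. l \<le> c" "\<forall>u\<in>set U3. c \<le> u"
    using real_between_lists by blast
  note c' = c[unfolded L3_U3_def, simplified]
  show thesis
  proof
    show "f x y \<le> sgnb x * a + sgnb y * b" for x y
      using b' by (cases x; cases y) (simp_all add: sgnb_def defs[symmetric])
    show "g x y \<le> sgnb x * b + sgnb y * c" for x y
      using c' by (cases x; cases y) (simp_all add: sgnb_def defs[symmetric])
    show "h x y \<le> sgnb x * a + sgnb y * c" for x y
      using c' by (cases x; cases y) (simp_all add: sgnb_def defs[symmetric])
  qed
qed

text \<open>Adding \<open>q + r\<close> turns the left side into the perimeters of two triangles. By
  \<open>bipartite_segments_cross\<close>, sides \<open>X i X k\<close> and \<open>U j U l\<close>
  are replaced by \<open>X i U j\<close> and \<open>X k U l\<close>; each new segment with the sides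
  opposite to its ends matches all six endpoints, which \<open>one\<close> bounds.\<close>

lemma half_triangles_le_matching:
  fixes P Q R :: "bool \<Rightarrow> point"
  defines "p \<equiv> norm (P True - P False)" and "q \<equiv> norm (Q True - Q False)" and "r \<equiv> norm (R True - R False)"
  assumes PQ: "\<And>x y. norm (P x - Q y) + norm (P (\<not> x) - Q (\<not> y)) \<le> p + q"
    and PR: "\<And>x z. norm (P x - R z) + norm (P (\<not> x) - R (\<not> z)) \<le> p + r"
    and cyc: "\<And>x y z. norm (P x - Q y) + norm (Q (\<not> y) - R z) + norm (P (\<not> x) - R (\<not> z)) \<le> p + q + r"
  shows "norm (P x - Q True) + norm (P x - Q False) + norm (P (\<not> x) - R True) + norm (P (\<not> x) - R False)
    \<le> 2 * p + q + r"
proof -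
  \<comment> \<open>\<open>oX i\<close> and \<open>oU j\<close> are the lengths of the sides opposite to \<open>X i\<close> and \<open>U j\<close>.\<close>
  define X where "X i = (if i = 0 then P x else Q (i = 1))" for i :: nat
  define U where "U j = (if j = 0 then P (\<not> x) else R (j = 1))" for j :: nat
  define oX where "oX i = (if i = 0 then q else norm (P x - Q (i \<noteq> 1)))" for i :: nat
  define oU where "oU j = (if j = 0 then r else norm (P (\<not> x) - R (j \<noteq> 1)))" for j :: nat
  have three: "n = 0 \<or> n = 1 \<or> n = 2" if "n < 3" for n :: nat using that by auto
  have sX: "oX i + oX k + norm (X i - X k) = q + norm (P x - Q True) + norm (P x - Q False)"
    if "i < 3" "k < 3" "i \<noteq> k" for i k
    using three[OF that(1)] three[OF that(2)] that(3)
    by (auto simp: X_def oX_def q_def norm_minus_commute)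
  have sU: "oU i + oU k + norm (U i - U k) = r + norm (P (\<not> x) - R True) + norm (P (\<not> x) - R False)"
    if "i < 3" "k < 3" "i \<noteq> k" for i k
    using three[OF that(1)] three[OF that(2)] that(3)
    by (auto simp: U_def oU_def r_def norm_minus_commute)
  have pp: "norm (P x - P (\<not> x)) = p"
    by (cases x) (simp_all add: p_def norm_minus_commute)
  have one: "norm (X i - U j) + oX i + oU j \<le> p + q + r" if "i < 3" "j < 3" for i j
    using three[OF that(1)] three[OF that(2)] pp PQ[of x True] PQ[of x False] PR[of x True] PR[of x False]
      cyc[of x True True] cyc[of x True False] cyc[of x False True] cyc[of x False False]
    by (auto simp: X_def U_def oX_def oU_def norm_minus_commute)
  obtain i k j l where ik: "i < 3" "k < 3" "j < 3" "l < 3" "i \<noteq> k" "j \<noteq> l"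
    and le: "norm (X i - X k) + norm (U j - U l) \<le> norm (X i - U j) + norm (X k - U l)"
    using bipartite_segments_cross[of X U] by blast
  show ?thesis
    using le one[OF ik(1,3)] one[OF ik(2,4)] sX[OF ik(1,2,5)] sU[OF ik(3,4,6)] by linarith
qed

lemma three_edges_common_point:
  fixes P Q R :: "bool \<Rightarrow> point"
  defines "p \<equiv> norm (P True - P False)" and "q \<equiv> norm (Q True - Q False)" and "r \<equiv> norm (R True - R False)"
  assumes PQ: "\<And>x y. norm (P x - Q y) + norm (P (\<not> x) - Q (\<not> y)) \<le> p + q"
    and PR: "\<And>x z. norm (P x - R z) + norm (P (\<not> x) - R (\<not> z)) \<le> p + r"
    and QR: "\<And>y z. norm (Q y - R z) + norm (Q (\<not> y) - R (\<not> z)) \<le> q + r"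
    and cyc: "\<And>x y z. norm (P x - Q y) + norm (Q (\<not> y) - R z) + norm (P (\<not> x) - R (\<not> z)) \<le> p + q + r"
  obtains c where "norm (P True - c) + norm (P False - c) \<le> 2 / sqrt 3 * p"
    and "norm (Q True - c) + norm (Q False - c) \<le> 2 / sqrt 3 * q"
    and "norm (R True - c) + norm (R False - c) \<le> 2 / sqrt 3 * r"
proof -
  \<comment> \<open>Excess of a cross distance over the two half lengths, the part that the unknowns
    \<open>a\<close>, \<open>b\<close>, \<open>c\<close> must cover.\<close>
  define f where "f x y = norm (P x - Q y) - (p + q) / 2" for x y
  define g where "g x y = norm (Q x - R y) - (q + r) / 2" for x y
  define h where "h x y = norm (P x - R y) - (p + r) / 2" for x y
  have QP: "norm (Q x - P y) + norm (Q (\<not> x) - P (\<not> y)) \<le> q + p" for x y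
    using PQ[of y x] by (simp add: norm_minus_commute)
  have RP: "norm (R x - P y) + norm (R (\<not> x) - P (\<not> y)) \<le> r + p" for x y
    using PR[of y x] by (simp add: norm_minus_commute)
  have RQ: "norm (R x - Q y) + norm (R (\<not> x) - Q (\<not> y)) \<le> r + q" for x y
    using QR[of y x] by (simp add: norm_minus_commute)
  have cyc2: "norm (Q x - P y) + norm (P (\<not> y) - R z) + norm (Q (\<not> x) - R (\<not> z)) \<le> q + p + r" for x y z
    using cyc[of y x "\<not> z"] by (simp add: norm_minus_commute)
  have cyc3: "norm (R x - P y) + norm (P (\<not> y) - Q z) + norm (R (\<not> x) - Q (\<not> z)) \<le> r + p + q" for x y z
    using cyc[of "\<not> y" z "\<not> x"] by (simp add: norm_minus_commute)
  note defs = p_def q_def r_def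
  \<comment> \<open>Each edge in turn has its ends split between the two triangles.\<close>
  note T1 = half_triangles_le_matching[OF PQ[unfolded defs] PR[unfolded defs] cyc[unfolded defs], folded defs]
  note T2 = half_triangles_le_matching[OF QP[unfolded defs] QR[unfolded defs] cyc2[unfolded defs], folded defs]
  note T3 = half_triangles_le_matching[OF RP[unfolded defs] RQ[unfolded defs] cyc3[unfolded defs], folded defs]
  obtain a b c where
    abc: "\<And>x y. f x y \<le> sgnb x * a + sgnb y * b" "\<And>x y. g x y \<le> sgnb x * b + sgnb y * c"
      "\<And>x y. h x y \<le> sgnb x * a + sgnb y * c"
  proof (rule potential_system_solvable[of f g h])
    show "f x y + f (\<not> x) (\<not> y) \<le> 0" for x y using PQ[of x y] by (simp add: f_def)
    show "g x y + g (\<not> x) (\<not> y) \<le> 0" for x y using QR[of x y] by (simp add: g_def)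
    show "h x y + h (\<not> x) (\<not> y) \<le> 0" for x y using PR[of x y] by (simp add: h_def)
    show "f x y + g (\<not> y) z + h (\<not> x) (\<not> z) \<le> 0" for x y z
      using cyc[of x y z] by (simp add: f_def g_def h_def field_simps)
    show "f x True + f x False + h (\<not> x) True + h (\<not> x) False \<le> 0" for x
      using T1[of x] by (simp add: f_def h_def)
    show "f True x + f False x + g (\<not> x) True + g (\<not> x) False \<le> 0" for x
      using T2[of x] by (simp add: f_def g_def norm_minus_commute)
    show "h True x + h False x + g True (\<not> x) + g False (\<not> x) \<le> 0" for x
      using T3[of x] by (simp add: h_def g_def norm_minus_commute)
  qed (rule that)
  define E where "E i = (if i = 0 then P else if i = 1 then Q else R)" for i :: nat
  define y where "y i x = (if i = 0 then p / 2 + sgnb x * a else if i = 1 then q / 2 + sgnb x * b else r / 2 + sgnb x * c)"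
    for i :: nat and x
  have cross: "norm (E i x - E j x') \<le> y i x + y j x'" if "i < 3" "j < 3" "i \<noteq> j" for i j x x'
  proof -
    have "i = 0 \<or> i = 1 \<or> i = 2" "j = 0 \<or> j = 1 \<or> j = 2" using that by auto
    then show ?thesis
      using that(3) abc(1)[of x x'] abc(1)[of x' x] abc(2)[of x x'] abc(2)[of x' x] abc(3)[of x x'] abc(3)[of x' x]
      by (auto simp: E_def y_def f_def g_def h_def norm_minus_commute field_simps)
  qed
  have edge: "y i True + y i False = norm (E i True - E i False)" for i
    by (simp add: y_def E_def sgnb_def p_def q_def r_def)
  \<comment> \<open>A disc must also meet itself; the triangle inequality over both ends of another
    edge gives this.\<close>
  have nonneg: "0 \<le> y i x" if "i < 3" for i x
  proof -
    define j where "j = Suc i mod 3"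
    have j: "j < 3" "i \<noteq> j" using that by (auto simp: j_def mod_Suc)
    have "norm (E j True - E j False) \<le> norm (E i x - E j True) + norm (E i x - E j False)"
      using norm_triangle_ineq4[of "E i x - E j False" "E i x - E j True"] by simp
    then show ?thesis
      using edge[of j] cross[OF that j, of x True] cross[OF that j, of x False] by linarith
  qed
  have meet: "norm (E i x - E j x') \<le> y i x + y j x'" if "i < 3" "j < 3" for i j x x'
  proof (cases "i = j")
    case True
    show ?thesis
    proof (cases "x = x'")
      case False
      then show ?thesis using True edge[of i] by (cases x) (auto simp: norm_minus_commute)
    qed (use True nonneg[OF that(1), of x] in simp)
  qed (use cross that in simp)
  obtain c where c: "\<And>z. z \<in> {..<3::nat} \<times> (UNIV :: bool set) \<Longrightarrow>
      norm (case_prod E z - c) \<le> 2 / sqrt 3 * case_prod y z"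
  proof (rule pairwise_intersecting_discs[of "{..<3::nat} \<times> (UNIV :: bool set)" "case_prod E" "case_prod y"])
    show "{..<3::nat} \<times> (UNIV :: bool set) \<noteq> {}" by (simp add: lessThan_empty_iff)
  qed (use meet in auto)
  have "norm (E i True - c) + norm (E i False - c) \<le> 2 / sqrt 3 * norm (E i True - E i False)" if "i < 3" for i
    using c[of "(i, True)"] c[of "(i, False)"] that by (simp add: distrib_left flip: edge)
  from this[of 0] this[of 1] this[of 2] show thesis
    by (intro that[of c]) (simp_all add: E_def p_def q_def r_def)
qed

section \<open>Helly's theorem over all edges\<close>

theorem theorem1:
  fixes S :: "point set" and M :: "point set set" and n :: nat
  assumes "n \<ge> 1" and "finite S" and "card S = 2 * n"
    and "max_sum_matching S M"
  shows "\<exists>c. \<forall>a b. {a, b} \<in> M \<longrightarrow>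
           norm (a - c) + norm (b - c) \<le> 2 / sqrt 3 * norm (a - b)"
proof -
  have M: "perfect_matching S M" using assms(4) by (simp add: max_sum_matching_def)
  have "\<forall>e\<in>M. \<exists>E :: bool \<Rightarrow> point. e = {E True, E False}"
  proof
    fix e assume "e \<in> M"
    then obtain a b where "e = {a, b}" using M by (auto simp: perfect_matching_def)
    then show "\<exists>E :: bool \<Rightarrow> point. e = {E True, E False}"
      by (intro exI[of _ "\<lambda>x. if x then a else b"]) simp
  qed
  \<comment> \<open>The ends are labelled by \<open>bool\<close>, so negation exchanges them and
    quantified labels cover every exchange.\<close>
  then obtain E :: "point set \<Rightarrow> bool \<Rightarrow> point" where E: "\<forall>e\<in>M. e = {E e True, E e False}"
    by (auto dest!: bchoice)
  define C where "C e = {x. norm (E e True - x) + norm (E e False - x) \<le> 2 / sqrt 3 * norm (E e True - E e False)}" for e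
  have mem: "{E e x, E e (\<not> x)} \<in> M" if "e \<in> M" for e x
    using E that by (cases x) (simp_all add: insert_commute)
  have len: "norm (E e x - E e (\<not> x)) = norm (E e True - E e False)" for e x
    by (cases x) (simp_all add: norm_minus_commute)
  note swap = max_sum_matching_swap[OF assms(2,4)]
  note cycle = max_sum_matching_cycle[OF assms(2,4)]
  have "M \<subseteq> Pow S" "\<Union>M = S" using M by (auto simp: perfect_matching_def)
  moreover have "S \<noteq> {}" using assms(1,3) by auto
  ultimately have fin: "finite M" "M \<noteq> {}" using \<open>finite S\<close> by (auto intro: finite_subset)
  have "(\<Inter>e\<in>M. C e) \<noteq> {}"
  proof (rule Helly_plane_indexed[OF fin])
    show "convex (C e)" for e unfolding C_def by (rule convex_ellipse)
  next
    fix e f g assume e: "e \<in> M" and f: "f \<in> M" and g: "g \<in> M"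
    have sw: "norm (E e x - E f y) + norm (E e (\<not> x) - E f (\<not> y))
        \<le> norm (E e True - E e False) + norm (E f True - E f False)" if "e \<in> M" "f \<in> M" for e f x y
      using swap[OF mem[OF that(1), of x] mem[OF that(2), of y]] by (simp only: len)
    have cy: "norm (E e x - E f y) + norm (E f (\<not> y) - E g z) + norm (E e (\<not> x) - E g (\<not> z))
        \<le> norm (E e True - E e False) + norm (E f True - E f False) + norm (E g True - E g False)" for x y z
      using cycle[OF mem[OF e, of "\<not> x"] mem[OF f, of y] mem[OF g, of z]] len[of e "\<not> x"] len[of f y] len[of g z]
      by (simp add: norm_minus_commute)
    show "C e \<inter> C f \<inter> C g \<noteq> {}"
      by (rule three_edges_common_point[OF sw[OF e f] sw[OF e g] sw[OF f g] cy])
        (auto simp: C_def)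
  qed
  then obtain c where c: "\<And>e. e \<in> M \<Longrightarrow> c \<in> C e" by blast
  have "norm (a - c) + norm (b - c) \<le> 2 / sqrt 3 * norm (a - b)" if "{a, b} \<in> M" for a b
  proof -
    define F where "F = E {a, b}"
    have "{a, b} = {F True, F False}"
      unfolding F_def using E that by (rule bspec)
    moreover have "norm (F True - c) + norm (F False - c) \<le> 2 / sqrt 3 * norm (F True - F False)"
      using c[OF that] by (simp add: C_def F_def)
    ultimately show ?thesis by (auto simp: doubleton_eq_iff norm_minus_commute)
  qed
  then show ?thesis by blast
qed

end
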